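(* Let $n\ge 3$ and let $P$ and $Q$ be disjoint strictly increasing $n$-cycles in $K_{2n}$ such that $P$ and $Q$ both consist of $n$ interior edges. For every integer $\ell$, the proportion of random book embeddings of $K_{2n}$ for which $P$ and $Q$ have linking number $\ell(P\cup Q)$ equal to $\ell$ is $$\frac{A(2n-1,\,n+\ell-1)}{(2n-1)!}.$$
   Context: Circular diagram. For $N\ge 4$, the vertices $v_1,\dots,v_N$ of the complete graph $K_N$ are placed at $N$ distinct points of a circle in clockwise order. Edges joining consecutive vertices $v_j,v_{j+1}$ (indices mod $N$) are called exterior edges and are drawn as arcs of the circle. The remaining $\binom{N}{2}-N$ edges are called interior edges and are projected to straight chords. Random book embedding. Each interior edge is placed on its own sheet (a disc bounded by the circle). The height order of the sheets is given by a uniformly random permutation $\sigma$ of $\{1,\dots,\binom N2-N\}$: interior edge $e_a$ lies above interior edge $e_b$ iff $\sigma(a)>\sigma(b)$. This determines an embedding of $K_N$ in $\mathbb{R}^3$ up to equivalence. Probabilities, proportions and means are with respect to $\sigma$. Strictly increasing cycles. Cycles are simple cycles of length at least $3$. An oriented cycle with consecutive edges $\overrightarrow{v_{i_1}v_{i_2}},\dots,\overrightarrow{v_{i_{k-1}}v_{i_k}},\overrightarrow{v_{i_k}v_{i_1}}$ is strictly increasing if some cyclic permutation $i_1',\dots,i_k'$ of $i_1,\dots,i_k$ satisfies $i_j'<i_{j+1}'$ for all $1\le j\le k-1$. Two cycles are disjoint if they share no vertex. Linking number. For disjoint oriented cycles $P,Q$ and a given embedding, $\ell(P\cup Q)$ is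 half the sum of the signs of the crossings, in the circular diagram, between an edge of $P$ and an edge of $Q$ (two chords cross when they meet in their interiors; only interior edges can cross). A crossing has sign $+1$ if (direction of the over-edge, direction of the under-edge) is a positively oriented basis of the plane, and $-1$ otherwise. Eulerian numbers. An ascent of a permutation $\tau\in S_r$ is a value $1\le k\le r-1$ with $\tau(k)<\tau(k+1)$. The Eulerian number $A(r,s)$ is the number of $\tau\in S_r$ with exactly $s$ ascents (so $A(r,s)=0$ if $s<0$ or $s\ge r$, for $r\geq 1$). *)

theory Defs
  imports "HOL-Probability.Probability" "HOL-Combinatorics.Permutations"
begin

text \<open>The vertices of \<open>K\<^sub>N\<close> are the labels \<open>1, \<dots>, N\<close>; an unoriented edge is a two-element set
  of labels, an oriented edge is a pair of labels.\<close>

definition complete_edges :: "nat \<Rightarrow> nat set set" where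
  "complete_edges N = {{i, j} | i j. i \<in> {1..N} \<and> j \<in> {1..N} \<and> i \<noteq> j}"

text \<open>The cyclic successor of \<open>j\<close> in \<open>{1..N}\<close> is \<open>j mod N + 1\<close>.\<close>

definition exterior_edges :: "nat \<Rightarrow> nat set set" where
  "exterior_edges N = {{j, j mod N + 1} | j. j \<in> {1..N}}"

definition interior_edges :: "nat \<Rightarrow> nat set set" where
  "interior_edges N = complete_edges N - exterior_edges N"

definition num_interior :: "nat \<Rightarrow> nat" where
  "num_interior N = (N choose 2) - N"

text \<open>The plane is the complex plane with its usual orientation, so going clockwise means that the
  angles decrease; all of them lie within less than one full turn of each other.\<close>

definition clockwise_placement :: "nat \<Rightarrow> (nat \<Rightarrow> complex) \<Rightarrow> bool" where
  "clockwise_placement N p \<longleftrightarrow>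
     (\<exists>c r \<theta>. r > 0 \<and> (\<forall>j\<in>{1..N}. p j = c + rcis r (\<theta> j)) \<and>
        (\<forall>j\<in>{1..N}. \<forall>k\<in>{1..N}. j < k \<longrightarrow> \<theta> k < \<theta> j \<and> \<theta> j < \<theta> k + 2 * pi))"

text \<open>A list represents the oriented cycle that visits its entries in order and then closes up;
  lists that differ by a rotation represent the same oriented cycle.\<close>

definition oriented_cycle :: "nat \<Rightarrow> nat list \<Rightarrow> bool" where
  "oriented_cycle N xs \<longleftrightarrow> length xs \<ge> 3 \<and> distinct xs \<and> set xs \<subseteq> {1..N}"

definition cycle_edges :: "nat list \<Rightarrow> (nat \<times> nat) set" where
  "cycle_edges xs = {(xs ! i, xs ! (Suc i mod length xs)) | i. i < length xs}"

definition strictly_increasing_cycle :: "nat list \<Rightarrow> bool" where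
  "strictly_increasing_cycle xs \<longleftrightarrow> (\<exists>m. sorted_wrt (<) (rotate m xs))"

definition undirected :: "nat \<times> nat \<Rightarrow> nat set" where
  "undirected e = {fst e, snd e}"

text \<open>The height relation of the book embedding given by the enumeration \<open>en\<close> of the interior edges
  by \<open>{1..M}\<close> and the permutation \<open>\<sigma>\<close> of \<open>{1..M}\<close>.\<close>

definition lies_above ::
    "nat \<Rightarrow> (nat \<Rightarrow> nat set) \<Rightarrow> (nat \<Rightarrow> nat) \<Rightarrow> nat set \<Rightarrow> nat set \<Rightarrow> bool" where
  "lies_above M en \<sigma> E F \<longleftrightarrow>
     (\<exists>a\<in>{1..M}. \<exists>b\<in>{1..M}. en a = E \<and> en b = F \<and> \<sigma> a > \<sigma> b)"

definition height_permutations :: "nat \<Rightarrow> (nat \<Rightarrow> nat) pmf" where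
  "height_permutations N = pmf_of_set {\<sigma>. \<sigma> permutes {1..num_interior N}}"

definition chords_cross :: "(nat \<Rightarrow> complex) \<Rightarrow> nat \<times> nat \<Rightarrow> nat \<times> nat \<Rightarrow> bool" where
  "chords_cross p e f \<longleftrightarrow>
     open_segment (p (fst e)) (p (snd e)) \<inter> open_segment (p (fst f)) (p (snd f)) \<noteq> {}"

definition direction :: "(nat \<Rightarrow> complex) \<Rightarrow> nat \<times> nat \<Rightarrow> complex" where
  "direction p e = p (snd e) - p (fst e)"

definition positive_basis :: "complex \<Rightarrow> complex \<Rightarrow> bool" where
  "positive_basis u v \<longleftrightarrow> Re u * Im v - Im u * Re v > 0"

definition crossing_sign ::
    "(nat \<Rightarrow> complex) \<Rightarrow> (nat set \<Rightarrow> nat set \<Rightarrow> bool) \<Rightarrow> nat \<times> nat \<Rightarrow> nat \<times> nat \<Rightarrow> int" where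
  "crossing_sign p over e f =
     (let (ov, un) = (if over (undirected e) (undirected f) then (e, f) else (f, e))
      in if positive_basis (direction p ov) (direction p un) then 1 else -1)"

definition crossings ::
    "nat \<Rightarrow> (nat \<Rightarrow> complex) \<Rightarrow> nat list \<Rightarrow> nat list \<Rightarrow> ((nat \<times> nat) \<times> (nat \<times> nat)) set" where
  "crossings N p P Q =
     {(e, f). e \<in> cycle_edges P \<and> f \<in> cycle_edges Q \<and>
        undirected e \<in> interior_edges N \<and> undirected f \<in> interior_edges N \<and>
        chords_cross p e f}"

text \<open>Real-valued, since that half the sum of the signs is an integer is a fact, not part of the
  definition.\<close>

definition linking_number ::
    "nat \<Rightarrow> (nat \<Rightarrow> complex) \<Rightarrow> (nat set \<Rightarrow> nat set \<Rightarrow> bool) \<Rightarrow> nat list \<Rightarrow> nat list \<Rightarrow> real" where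
  "linking_number N p over P Q =
     real_of_int (\<Sum>(e, f)\<in>crossings N p P Q. crossing_sign p over e f) / 2"

text \<open>The second argument is an integer, so that the number is zero for negative values.\<close>

definition eulerian :: "nat \<Rightarrow> int \<Rightarrow> nat" where
  "eulerian r s =
     card {\<tau>. \<tau> permutes {1..r} \<and> int (card {k. 1 \<le> k \<and> k < r \<and> \<tau> k < \<tau> (k + 1)}) = s}"

end

theory Submission imports Defs begin

text \<open>Neither cycle contains two neighbouring vertices of the circle, so one of them runs through the odd
  vertices and the other through the even ones (\<open>strictly_increasing_interior_cycle\<close>). Writing \<open>N = 2 * n\<close>,
  their edges together are the \<open>N\<close> oriented chords from \<open>i\<close> to \<open>i + 2\<close>, with indices modulo \<open>N\<close>. The chord
  at \<open>i\<close> lies on one cycle and crosses exactly two chords of the other, those at \<open>i - 1\<close> and \<open>i + 1\<close>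
  (\<open>skip_edges_cross_iff\<close>). There are thus \<open>N\<close> crossings, arranged cyclically, and since the directions of
  these chords turn clockwise, the crossing of the chords at \<open>i\<close> and \<open>i + 1\<close> has sign \<open>1\<close> when the height
  increases from \<open>i\<close> to \<open>i + 1\<close> and \<open>- 1\<close> otherwise. Half the sum of the signs is therefore the number of
  cyclic ascents of the height sequence minus \<open>n\<close> (\<open>sum_crossing_signs\<close>).

  The heights of these \<open>N\<close> chords are in uniformly random relative order (\<open>relative_order_uniform\<close>), so the
  linking number is \<open>l\<close> with the probability that a random permutation of \<open>{1..N}\<close> has \<open>n + l\<close> cyclic
  ascents. Cyclic ascents are invariant under rotation. Rotating the maximum to the last place removes
  exactly one of them and leaves the ordinary ascents of a permutation of \<open>{1..N - 1}\<close>; so there are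
  \<open>N\<close> times the Eulerian number of \<open>N - 1\<close> and \<open>n + l - 1\<close> such permutations (\<open>card_cyclic_ascents\<close>), and
  division by \<open>fact N\<close> gives the claim.\<close>

section \<open>Cyclic ascents of permutations\<close>

text \<open>Outside \<open>{1..N}\<close> the successor is the identity, so that it is a permutation of \<open>{1..N}\<close> in the
  sense of \<open>permutes\<close> and rotating a permutation is composition with it.\<close>

definition cyclic_succ :: "nat \<Rightarrow> nat \<Rightarrow> nat" where
  "cyclic_succ N i = (if i \<in> {1..N} then i mod N + 1 else i)"

definition cyclic_ascents :: "nat \<Rightarrow> (nat \<Rightarrow> nat) \<Rightarrow> nat" where
  "cyclic_ascents N f = card {i \<in> {1..N}. f i < f (cyclic_succ N i)}"

lemma cyclic_succ_less: "1 \<le> i \<Longrightarrow> i < N \<Longrightarrow> cyclic_succ N i = i + 1"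
  by (simp add: cyclic_succ_def)

lemma cyclic_succ_last: "1 \<le> N \<Longrightarrow> cyclic_succ N N = 1"
  by (simp add: cyclic_succ_def)

lemma cyclic_succ_cases:
  assumes "i \<in> {1..N}"
  shows "i < N \<and> cyclic_succ N i = i + 1 \<or> i = N \<and> cyclic_succ N i = 1"
  using assms cyclic_succ_less[of i N] cyclic_succ_last[of N] by force

lemma cyclic_succ_permutes: "cyclic_succ N permutes {1..N}"
proof (rule bij_imp_permutes)
  have "inj_on (cyclic_succ N) {1..N}"
  proof (rule inj_onI)
    fix i j assume "i \<in> {1..N}" "j \<in> {1..N}" "cyclic_succ N i = cyclic_succ N j"
    then show "i = j"
      using cyclic_succ_cases[of i N] cyclic_succ_cases[of j N] by auto
  qed
  moreover have "cyclic_succ N ` {1..N} \<subseteq> {1..N}"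
  proof
    fix y assume "y \<in> cyclic_succ N ` {1..N}"
    then obtain i where "i \<in> {1..N}" "y = cyclic_succ N i" by blast
    then show "y \<in> {1..N}" using cyclic_succ_cases[of i N] by auto
  qed
  ultimately show "bij_betw (cyclic_succ N) {1..N} {1..N}"
    by (simp add: bij_betw_def endo_inj_surj)
qed (auto simp: cyclic_succ_def)

lemma cyclic_succ_in: "i \<in> {1..N} \<Longrightarrow> cyclic_succ N i \<in> {1..N}"
  using permutes_in_image[OF cyclic_succ_permutes] by blast

lemma cyclic_ascents_rotate: "cyclic_ascents N (f \<circ> cyclic_succ N) = cyclic_ascents N f"
proof -
  let ?c = "cyclic_succ N"
  have c: "bij_betw ?c {1..N} {1..N}"
    by (rule permutes_imp_bij[OF cyclic_succ_permutes])
  have "bij_betw ?c {i \<in> {1..N}. f (?c i) < f (?c (?c i))} {i \<in> {1..N}. f i < f (?c i)}"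
    unfolding bij_betw_def
  proof
    show "inj_on ?c {i \<in> {1..N}. f (?c i) < f (?c (?c i))}"
      using c by (auto simp: bij_betw_def intro: inj_on_subset)
    show "?c ` {i \<in> {1..N}. f (?c i) < f (?c (?c i))} = {i \<in> {1..N}. f i < f (?c i)}"
    proof (intro equalityI subsetI)
      fix y assume y: "y \<in> {i \<in> {1..N}. f i < f (?c i)}"
      then obtain i where "i \<in> {1..N}" "y = ?c i"
        using c unfolding bij_betw_def by blast
      with y show "y \<in> ?c ` {i \<in> {1..N}. f (?c i) < f (?c (?c i))}" by blast
    qed (use cyclic_succ_in in blast)
  qed
  then show ?thesis
    unfolding cyclic_ascents_def comp_def by (rule bij_betw_same_card)
qed

text \<open>Rotating a permutation shifts the position of its maximum by one and keeps its cyclic ascents, so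
  every position of the maximum is equally frequent.\<close>

lemma card_cyclic_ascents_max_position:
  assumes "j \<in> {1..N}"
  shows "card {\<tau>. \<tau> permutes {1..N} \<and> int (cyclic_ascents N \<tau>) = s \<and> \<tau> j = N}
       = card {\<tau>. \<tau> permutes {1..N} \<and> int (cyclic_ascents N \<tau>) = s \<and> \<tau> N = N}"
proof -
  let ?c = "cyclic_succ N"
  let ?S = "\<lambda>j. {\<tau>. \<tau> permutes {1..N} \<and> int (cyclic_ascents N \<tau>) = s \<and> \<tau> j = N}"
  have step: "card (?S (?c j)) = card (?S j)" for j
  proof (rule bij_betw_same_card)
    show "bij_betw (\<lambda>\<tau>. \<tau> \<circ> ?c) (?S (?c j)) (?S j)"
    proof (rule bij_betw_byWitness[where f' = "\<lambda>\<tau>. \<tau> \<circ> inv ?c"])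
      note i = permutes_inv_o[OF cyclic_succ_permutes[of N]]
      show "\<forall>\<tau>\<in>?S (?c j). \<tau> \<circ> ?c \<circ> inv ?c = \<tau>" by (simp add: o_assoc[symmetric] i)
      show "\<forall>\<tau>\<in>?S j. \<tau> \<circ> inv ?c \<circ> ?c = \<tau>" by (simp add: o_assoc[symmetric] i)
      show "(\<lambda>\<tau>. \<tau> \<circ> ?c) ` ?S (?c j) \<subseteq> ?S j"
        by (auto simp: cyclic_ascents_rotate simp del: One_nat_def
            intro: permutes_compose[OF cyclic_succ_permutes])
      have "cyclic_ascents N (\<tau> \<circ> inv ?c) = cyclic_ascents N \<tau>" for \<tau>
        using cyclic_ascents_rotate[of N "\<tau> \<circ> inv ?c"] by (simp add: o_assoc[symmetric] i)
      then show "(\<lambda>\<tau>. \<tau> \<circ> inv ?c) ` ?S j \<subseteq> ?S (?c j)"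
        by (auto simp: permutes_inverses[OF cyclic_succ_permutes] simp del: One_nat_def
            intro: permutes_compose[OF permutes_inv[OF cyclic_succ_permutes]])
    qed
  qed
  show ?thesis
    using assms
  proof (induction "N - j" arbitrary: j)
    case (Suc d)
    then have "?c j = Suc j" "Suc j \<in> {1..N}" "d = N - Suc j"
      using cyclic_succ_less[of j N] by auto
    then show ?case using Suc.hyps(1) step[of j] by simp
  qed auto
qed

lemma permutes_fixing_last_iff:
  fixes N :: nat
  assumes "N \<ge> 1"
  shows "\<tau> permutes {1..N} \<and> \<tau> N = N \<longleftrightarrow> \<tau> permutes {1..N - 1}"
proof
  assume \<tau>: "\<tau> permutes {1..N} \<and> \<tau> N = N"
  have "x = N" if "x \<in> {1..N} - {1..N - 1}" for x using that by force
  with \<tau> have "\<tau> x = x" if "x \<in> {1..N} - {1..N - 1}" for x using that by metis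
  then show "\<tau> permutes {1..N - 1}" using \<tau> permutes_superset by blast
next
  assume \<tau>: "\<tau> permutes {1..N - 1}"
  then have "\<tau> permutes {1..N}" by (rule permutes_subset) auto
  moreover have "\<tau> N = N" using \<tau> assms by (intro permutes_not_in) auto
  ultimately show "\<tau> permutes {1..N} \<and> \<tau> N = N" ..
qed

text \<open>When the maximum stands at the end, the step into it is always an ascent and the closing step out
  of it never is; the other steps are those of the linear word in front of it.\<close>

lemma cyclic_ascents_max_last:
  assumes "\<tau> permutes {1..N - 1}" "N \<ge> 2"
  shows "cyclic_ascents N \<tau> = Suc (card {k. 1 \<le> k \<and> k < N - 1 \<and> \<tau> k < \<tau> (k + 1)})"
proof -
  let ?A = "{k. 1 \<le> k \<and> k < N - 1 \<and> \<tau> k < \<tau> (k + 1)}"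
  have last: "\<tau> N = N" using assms by (intro permutes_not_in) auto
  have lt: "\<tau> k < N" if "k \<in> {1..N - 1}" for k
    using permutes_in_image[OF assms(1), of k] that by auto
  have "{i \<in> {1..N}. \<tau> i < \<tau> (cyclic_succ N i)} = insert (N - 1) ?A"
  proof (rule set_eqI)
    fix i
    consider "i \<notin> {1..N}" | "i = N" | "i = N - 1" | "1 \<le> i" "i < N - 1" by fastforce
    then show "i \<in> {i \<in> {1..N}. \<tau> i < \<tau> (cyclic_succ N i)} \<longleftrightarrow> i \<in> insert (N - 1) ?A"
    proof cases
      case 2
      then show ?thesis using lt[of 1] last assms(2) cyclic_succ_last[of N] by (auto simp: Suc_le_eq)
    next
      case 3
      then show ?thesis using lt[of "N - 1"] last assms cyclic_succ_less[of "N - 1" N] by auto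
    next
      case 4
      then show ?thesis using cyclic_succ_less[of i N] by auto
    qed (use assms in auto)
  qed
  moreover have "finite ?A" by (rule finite_subset[of _ "{..N}"]) auto
  ultimately show ?thesis unfolding cyclic_ascents_def by simp
qed

text \<open>Sorting by the position of the maximum reduces each of the \<open>N\<close> classes to the linear words counted
  by the Eulerian numbers.\<close>

lemma card_cyclic_ascents:
  assumes "N \<ge> 2"
  shows "card {\<tau>. \<tau> permutes {1..N} \<and> int (cyclic_ascents N \<tau>) = s} = N * eulerian (N - 1) (s - 1)"
proof -
  let ?S = "\<lambda>j. {\<tau>. \<tau> permutes {1..N} \<and> int (cyclic_ascents N \<tau>) = s \<and> \<tau> j = N}"
  have "?S N = {\<tau>. \<tau> permutes {1..N - 1} \<and> int (cyclic_ascents N \<tau>) = s}"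
    using permutes_fixing_last_iff[of N] assms by auto
  also have "\<dots> = {\<tau>. \<tau> permutes {1..N - 1} \<and>
      int (card {k. 1 \<le> k \<and> k < N - 1 \<and> \<tau> k < \<tau> (k + 1)}) = s - 1}"
    using assms by (auto simp: cyclic_ascents_max_last)
  finally have SN: "card (?S N) = eulerian (N - 1) (s - 1)" by (simp add: eulerian_def)
  have "{\<tau>. \<tau> permutes {1..N} \<and> int (cyclic_ascents N \<tau>) = s} = (\<Union>j\<in>{1..N}. ?S j)"
  proof (intro equalityI subsetI)
    fix \<tau> assume \<tau>: "\<tau> \<in> {\<tau>. \<tau> permutes {1..N} \<and> int (cyclic_ascents N \<tau>) = s}"
    then have "N \<in> \<tau> ` {1..N}" using permutes_image[of \<tau> "{1..N}"] assms by auto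
    then obtain j where "j \<in> {1..N}" "\<tau> j = N" by auto
    with \<tau> show "\<tau> \<in> (\<Union>j\<in>{1..N}. ?S j)" by blast
  qed auto
  also have "card \<dots> = (\<Sum>j\<in>{1..N}. card (?S j))"
  proof (rule card_UN_disjoint)
    show "\<forall>j\<in>{1..N}. finite (?S j)"
      by (auto intro: finite_subset[OF _ finite_permutations[of "{1..N}"]])
    have "i = j" if "\<tau> permutes {1..N}" "\<tau> i = N" "\<tau> j = N" for \<tau> i j
      using permutes_inj[OF that(1)] that(2,3) by (metis injD)
    then show "\<forall>i\<in>{1..N}. \<forall>j\<in>{1..N}. i \<noteq> j \<longrightarrow> ?S i \<inter> ?S j = {}" by blast
  qed simp
  also have "\<dots> = (\<Sum>j\<in>{1..N}. eulerian (N - 1) (s - 1))"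
    by (rule sum.cong) (simp_all only: card_cyclic_ascents_max_position SN)
  finally show ?thesis by simp
qed

section \<open>The relative order of a uniformly random permutation\<close>

lemma ex_rank_permutation:
  fixes g :: "nat \<Rightarrow> 'a::linorder"
  assumes "inj_on g {1..N}"
  obtains r where "r permutes {1..N}"
    "\<And>i j. i \<in> {1..N} \<Longrightarrow> j \<in> {1..N} \<Longrightarrow> r i < r j \<longleftrightarrow> g i < g j"
proof
  define r where "r i = (if i \<in> {1..N} then card {j \<in> {1..N}. g j \<le> g i} else i)" for i
  have mono: "r i < r j" if "i \<in> {1..N}" "j \<in> {1..N}" "g i < g j" for i j
  proof -
    have "{k \<in> {1..N}. g k \<le> g i} \<subset> {k \<in> {1..N}. g k \<le> g j}"
    proof
      show "{k \<in> {1..N}. g k \<le> g i} \<subseteq> {k \<in> {1..N}. g k \<le> g j}"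
        using that(3) by auto
      have "j \<in> {k \<in> {1..N}. g k \<le> g j}" "j \<notin> {k \<in> {1..N}. g k \<le> g i}" using that by auto
      then show "{k \<in> {1..N}. g k \<le> g i} \<noteq> {k \<in> {1..N}. g k \<le> g j}" by blast
    qed
    then show ?thesis using that by (simp add: r_def psubset_card_mono)
  qed
  show less_iff: "r i < r j \<longleftrightarrow> g i < g j" if "i \<in> {1..N}" "j \<in> {1..N}" for i j
  proof
    assume "r i < r j"
    then show "g i < g j"
      using mono[of j i] that inj_onD[OF assms, of i j] by (metis less_asym less_irrefl linorder_neqE)
  qed (use mono that in blast)
  show "r permutes {1..N}"
  proof (rule bij_imp_permutes)
    have "inj_on r {1..N}"
      using mono inj_onD[OF assms] by (intro inj_onI) (metis less_irrefl linorder_neqE)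
    moreover have "r ` {1..N} \<subseteq> {1..N}"
    proof
      fix y assume "y \<in> r ` {1..N}"
      then obtain i where i: "i \<in> {1..N}" "y = card {j \<in> {1..N}. g j \<le> g i}" by (auto simp: r_def)
      have "card {j \<in> {1..N}. g j \<le> g i} > 0" using i(1) by (subst card_gt_0_iff) auto
      moreover have "card {j \<in> {1..N}. g j \<le> g i} \<le> card {1..N}" by (intro card_mono) auto
      ultimately show "y \<in> {1..N}" unfolding i(2) by simp
    qed
    ultimately show "bij_betw r {1..N} {1..N}" by (simp add: bij_betw_def endo_inj_surj)
  qed (auto simp: r_def)
qed

text \<open>Distinct entries of a uniformly random permutation of a finite set \<open>S\<close> are in uniformly random
  relative order. The hypothesis on \<open>\<Phi>\<close> says that it depends on the relative order alone.

  The proof counts the pairs \<open>(\<sigma>, \<tau>)\<close> with \<open>\<Phi> (\<sigma> \<circ> a \<circ> \<tau>)\<close> in two ways. For fixed \<open>\<tau>\<close>, a permutation of the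
  selected positions extends to one of \<open>S\<close> that is absorbed by \<open>\<sigma>\<close>; for fixed \<open>\<sigma>\<close>, the values \<open>\<sigma> \<circ> a\<close> may
  be replaced by their ranks, which form a permutation of \<open>{1..N}\<close> that is absorbed by \<open>\<tau>\<close>.\<close>

lemma relative_order_uniform:
  fixes a :: "nat \<Rightarrow> nat" and \<Phi> :: "(nat \<Rightarrow> nat) \<Rightarrow> bool"
  assumes S: "finite S" and a: "inj_on a {1..N}" "a ` {1..N} \<subseteq> S"
    and \<Phi>: "\<And>f g. (\<And>i j. i \<in> {1..N} \<Longrightarrow> j \<in> {1..N} \<Longrightarrow> f i < f j \<longleftrightarrow> g i < g j) \<Longrightarrow> \<Phi> f \<longleftrightarrow> \<Phi> g"
  shows "fact N * card {\<sigma>. \<sigma> permutes S \<and> \<Phi> (\<sigma> \<circ> a)}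
       = fact (card S) * card {\<tau>. \<tau> permutes {1..N} \<and> \<Phi> \<tau>}"
proof -
  let ?\<Sigma> = "{\<sigma>. \<sigma> permutes S}" and ?T = "{\<tau>. \<tau> permutes {1..N}}"
  have fin: "finite ?\<Sigma>" "finite ?T" using S by (auto intro: finite_permutations)
  have by_\<tau>: "card {\<sigma> \<in> ?\<Sigma>. \<Phi> (\<sigma> \<circ> a \<circ> \<tau>)} = card {\<sigma> \<in> ?\<Sigma>. \<Phi> (\<sigma> \<circ> a)}" if \<tau>: "\<tau> \<in> ?T" for \<tau>
  proof -
    \<comment> \<open>\<open>\<pi>\<close> is \<open>\<tau>\<close> transported along \<open>a\<close> and extended by the identity.\<close>
    define \<pi> where "\<pi> x = (if x \<in> a ` {1..N} then a (\<tau> (inv_into {1..N} a x)) else x)" for x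
    have "\<pi> permutes a ` {1..N}"
      using permutes_bij_inv_into[of \<tau> "{1..N}" a "a ` {1..N}"] \<tau> a(1)
      by (simp add: \<pi>_def[abs_def] bij_betw_def)
    then have \<pi>: "\<pi> permutes S" using a(2) by (rule permutes_subset)
    have conj: "\<pi> (a i) = a (\<tau> i)" if "i \<in> {1..N}" for i
      using that a(1) by (simp add: \<pi>_def)
    have eq: "\<Phi> (\<sigma> \<circ> a \<circ> \<tau>) \<longleftrightarrow> \<Phi> ((\<sigma> \<circ> \<pi>) \<circ> a)" for \<sigma>
      by (rule \<Phi>) (simp add: conj)
    have "bij_betw (\<lambda>\<sigma>. \<sigma> \<circ> \<pi>) {\<sigma> \<in> ?\<Sigma>. \<Phi> (\<sigma> \<circ> a \<circ> \<tau>)} {\<sigma> \<in> ?\<Sigma>. \<Phi> (\<sigma> \<circ> a)}"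
    proof (rule bij_betw_byWitness[where f' = "\<lambda>\<sigma>. \<sigma> \<circ> inv \<pi>"])
      note i = permutes_inv_o[OF \<pi>]
      show "\<forall>\<sigma>\<in>{\<sigma> \<in> ?\<Sigma>. \<Phi> (\<sigma> \<circ> a \<circ> \<tau>)}. \<sigma> \<circ> \<pi> \<circ> inv \<pi> = \<sigma>"
        "\<forall>\<sigma>\<in>{\<sigma> \<in> ?\<Sigma>. \<Phi> (\<sigma> \<circ> a)}. \<sigma> \<circ> inv \<pi> \<circ> \<pi> = \<sigma>"
        by (simp_all add: o_assoc[symmetric] i)
      show "(\<lambda>\<sigma>. \<sigma> \<circ> \<pi>) ` {\<sigma> \<in> ?\<Sigma>. \<Phi> (\<sigma> \<circ> a \<circ> \<tau>)} \<subseteq> {\<sigma> \<in> ?\<Sigma>. \<Phi> (\<sigma> \<circ> a)}"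
        using eq by (auto intro: permutes_compose[OF \<pi>])
      have "\<sigma> \<circ> inv \<pi> \<circ> \<pi> = \<sigma>" for \<sigma> :: "nat \<Rightarrow> nat" by (simp add: o_assoc[symmetric] i)
      then show "(\<lambda>\<sigma>. \<sigma> \<circ> inv \<pi>) ` {\<sigma> \<in> ?\<Sigma>. \<Phi> (\<sigma> \<circ> a)} \<subseteq> {\<sigma> \<in> ?\<Sigma>. \<Phi> (\<sigma> \<circ> a \<circ> \<tau>)}"
        using eq by (auto intro: permutes_compose[OF permutes_inv[OF \<pi>]])
    qed
    then show ?thesis by (rule bij_betw_same_card)
  qed
  have by_\<sigma>: "card {\<tau> \<in> ?T. \<Phi> (\<sigma> \<circ> a \<circ> \<tau>)} = card {\<tau> \<in> ?T. \<Phi> \<tau>}" if \<sigma>: "\<sigma> \<in> ?\<Sigma>" for \<sigma>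
  proof -
    have "inj_on (\<sigma> \<circ> a) {1..N}"
      using \<sigma> a(1) by (auto intro!: comp_inj_on intro: permutes_inj_on)
    from ex_rank_permutation[OF this] obtain r where r: "r permutes {1..N}"
      and less: "\<And>i j. i \<in> {1..N} \<Longrightarrow> j \<in> {1..N} \<Longrightarrow> r i < r j \<longleftrightarrow> (\<sigma> \<circ> a) i < (\<sigma> \<circ> a) j"
      by blast
    have eq: "\<Phi> (\<sigma> \<circ> a \<circ> \<tau>) \<longleftrightarrow> \<Phi> (r \<circ> \<tau>)" if "\<tau> \<in> ?T" for \<tau>
    proof (rule \<Phi>)
      fix i j assume "i \<in> {1..N}" "j \<in> {1..N}"
      with that have "\<tau> i \<in> {1..N}" "\<tau> j \<in> {1..N}"
        using permutes_in_image[of \<tau> "{1..N}"] by auto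
      then show "(\<sigma> \<circ> a \<circ> \<tau>) i < (\<sigma> \<circ> a \<circ> \<tau>) j \<longleftrightarrow> (r \<circ> \<tau>) i < (r \<circ> \<tau>) j" using less by simp
    qed
    have "bij_betw (\<lambda>\<tau>. r \<circ> \<tau>) {\<tau> \<in> ?T. \<Phi> (\<sigma> \<circ> a \<circ> \<tau>)} {\<tau> \<in> ?T. \<Phi> \<tau>}"
    proof (rule bij_betw_byWitness[where f' = "\<lambda>\<tau>. inv r \<circ> \<tau>"])
      note i = permutes_inv_o[OF r]
      show "\<forall>\<tau>\<in>{\<tau> \<in> ?T. \<Phi> (\<sigma> \<circ> a \<circ> \<tau>)}. inv r \<circ> (r \<circ> \<tau>) = \<tau>" "\<forall>\<tau>\<in>{\<tau> \<in> ?T. \<Phi> \<tau>}. r \<circ> (inv r \<circ> \<tau>) = \<tau>"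
        by (simp_all add: o_assoc i)
      show "(\<lambda>\<tau>. r \<circ> \<tau>) ` {\<tau> \<in> ?T. \<Phi> (\<sigma> \<circ> a \<circ> \<tau>)} \<subseteq> {\<tau> \<in> ?T. \<Phi> \<tau>}"
        using eq by (auto simp del: One_nat_def intro: permutes_compose[OF _ r])
      have "r \<circ> (inv r \<circ> \<tau>) = \<tau>" for \<tau> :: "nat \<Rightarrow> nat" by (simp add: o_assoc i)
      moreover have "inv r \<circ> \<tau> \<in> ?T" if "\<tau> \<in> ?T" for \<tau>
        using that permutes_compose[OF _ permutes_inv[OF r]] by simp
      ultimately show "(\<lambda>\<tau>. inv r \<circ> \<tau>) ` {\<tau> \<in> ?T. \<Phi> \<tau>} \<subseteq> {\<tau> \<in> ?T. \<Phi> (\<sigma> \<circ> a \<circ> \<tau>)}"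
        using eq by auto
    qed
    then show ?thesis by (rule bij_betw_same_card)
  qed
  have count: "card {x \<in> X. R x} = (\<Sum>x\<in>X. if R x then 1 else 0)" if "finite X"
    for X and R :: "(nat \<Rightarrow> nat) \<Rightarrow> bool"
    using that by (simp add: sum.If_cases Int_def)
  have "fact N * card {\<sigma> \<in> ?\<Sigma>. \<Phi> (\<sigma> \<circ> a)} = (\<Sum>\<tau>\<in>?T. card {\<sigma> \<in> ?\<Sigma>. \<Phi> (\<sigma> \<circ> a)})"
    by (simp add: card_permutations)
  also have "\<dots> = (\<Sum>\<tau>\<in>?T. card {\<sigma> \<in> ?\<Sigma>. \<Phi> (\<sigma> \<circ> a \<circ> \<tau>)})"
    by (rule sum.cong[OF refl]) (simp only: by_\<tau>)
  also have "\<dots> = (\<Sum>\<sigma>\<in>?\<Sigma>. card {\<tau> \<in> ?T. \<Phi> (\<sigma> \<circ> a \<circ> \<tau>)})"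
    unfolding count[OF fin(1)] count[OF fin(2)] by (rule sum.swap)
  also have "\<dots> = (\<Sum>\<sigma>\<in>?\<Sigma>. card {\<tau> \<in> ?T. \<Phi> \<tau>})"
    by (rule sum.cong[OF refl]) (simp only: by_\<sigma>)
  also have "\<dots> = fact (card S) * card {\<tau> \<in> ?T. \<Phi> \<tau>}"
    using S by (simp add: card_permutations)
  finally show ?thesis by simp
qed

section \<open>Crossing chords of a circle\<close>

text \<open>Twice the signed area of the triangle; it is negative when the vertices are in clockwise order.\<close>

definition orient :: "complex \<Rightarrow> complex \<Rightarrow> complex \<Rightarrow> real" where
  "orient A B C = Re (B - A) * Im (C - A) - Im (B - A) * Re (C - A)"

lemma orient_rotate: "orient B C A = orient A B C"
  by (simp add: orient_def algebra_simps)

lemma orient_affine: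
  "orient A B ((1 - t) *\<^sub>R C + t *\<^sub>R D) = (1 - t) * orient A B C + t * orient A B D"
  by (simp add: orient_def algebra_simps)

lemma sin_sum_eq_product:
  fixes x y :: real
  shows "sin (2 * x) + sin (2 * y) - sin (2 * (x + y)) = 4 * sin x * sin y * sin (x + y)"
proof -
  have "sin (2 * x) + sin (2 * y) = sin ((x + y) + (x - y)) + sin ((x + y) - (x - y))"
    by (simp add: algebra_simps)
  also have "\<dots> = 2 * sin (x + y) * cos (x - y)"
    by (simp only: sin_add[of "x + y" "x - y"] sin_diff[of "x + y" "x - y"])
  finally have "sin (2 * x) + sin (2 * y) - sin (2 * (x + y))
      = 2 * sin (x + y) * (cos (x - y) - cos (x + y))"
    by (simp only: sin_double[of "x + y"] right_diff_distrib)
  then show ?thesis by (simp only: cos_diff cos_add) simp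
qed

text \<open>For three points in clockwise order on a circle, each of the three half-angle differences lies
  strictly between \<open>- pi\<close> and \<open>0\<close>, so this product shows that the orientation is negative.\<close>

lemma orient_on_circle:
  "orient (c + rcis r \<alpha>) (c + rcis r \<beta>) (c + rcis r \<gamma>)
     = 4 * r\<^sup>2 * sin ((\<beta> - \<alpha>) / 2) * sin ((\<gamma> - \<beta>) / 2) * sin ((\<gamma> - \<alpha>) / 2)"
proof -
  have "orient (c + rcis r \<alpha>) (c + rcis r \<beta>) (c + rcis r \<gamma>)
      = r\<^sup>2 * (sin (\<beta> - \<alpha>) + sin (\<gamma> - \<beta>) - sin (\<gamma> - \<alpha>))"
    by (simp add: orient_def sin_diff algebra_simps power2_eq_square)
  also have "sin (\<beta> - \<alpha>) + sin (\<gamma> - \<beta>) - sin (\<gamma> - \<alpha>)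
      = 4 * sin ((\<beta> - \<alpha>) / 2) * sin ((\<gamma> - \<beta>) / 2) * sin ((\<gamma> - \<alpha>) / 2)"
  proof -
    have "(\<beta> - \<alpha>) / 2 + (\<gamma> - \<beta>) / 2 = (\<gamma> - \<alpha>) / 2" "2 * (\<delta> / 2) = \<delta>" for \<delta> :: real
      by (simp_all add: field_simps)
    then show ?thesis
      using sin_sum_eq_product[of "(\<beta> - \<alpha>) / 2" "(\<gamma> - \<beta>) / 2"] by (simp only:)
  qed
  finally show ?thesis by simp
qed

text \<open>Being in clockwise order is unchanged by rotating the triple, hence the three alternatives.\<close>

definition clockwise3 :: "nat \<Rightarrow> nat \<Rightarrow> nat \<Rightarrow> bool" where
  "clockwise3 i j k \<longleftrightarrow> i < j \<and> j < k \<or> j < k \<and> k < i \<or> k < i \<and> i < j"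

lemma clockwise_placement_orient:
  assumes "clockwise_placement N p" "clockwise3 i j k" "{i, j, k} \<subseteq> {1..N}"
  shows "orient (p i) (p j) (p k) < 0"
proof -
  obtain c r \<theta> where r: "r > 0" and p: "\<And>j. j \<in> {1..N} \<Longrightarrow> p j = c + rcis r (\<theta> j)"
    and \<theta>: "\<And>j k. j \<in> {1..N} \<Longrightarrow> k \<in> {1..N} \<Longrightarrow> j < k \<Longrightarrow> \<theta> k < \<theta> j \<and> \<theta> j < \<theta> k + 2 * pi"
    using assms(1) unfolding clockwise_placement_def by blast
  have neg: "orient (p i) (p j) (p k) < 0" if "i < j" "j < k" "{i, j, k} \<subseteq> {1..N}" for i j k
  proof -
    have s: "sin ((\<theta> b - \<theta> a) / 2) < 0" if "a \<in> {1..N}" "b \<in> {1..N}" "a < b" for a b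
    proof -
      have "sin ((\<theta> a - \<theta> b) / 2) > 0"
        using \<theta>[OF that] by (intro sin_gt_zero) simp_all
      moreover have "(\<theta> b - \<theta> a) / 2 = - ((\<theta> a - \<theta> b) / 2)"
        by (simp add: field_simps)
      ultimately show ?thesis by (simp only: sin_minus neg_less_0_iff_less)
    qed
    have "sin ((\<theta> j - \<theta> i) / 2) < 0" "sin ((\<theta> k - \<theta> j) / 2) < 0" "sin ((\<theta> k - \<theta> i) / 2) < 0"
      using that by (auto intro!: s)
    then show ?thesis
      using that r by (simp add: p orient_on_circle mult_neg_neg mult_pos_neg)
  qed
  show ?thesis
    using assms(2,3) neg[of i j k] neg[of j k i] neg[of k i j]
      orient_rotate[of "p j" "p k" "p i"] orient_rotate[of "p i" "p j" "p k"]
    unfolding clockwise3_def by auto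
qed

text \<open>The line through the first chord is where the affine function \<open>orient\<close> vanishes; a chord with both
  endpoints strictly on one side of it cannot meet it.\<close>

lemma same_side_not_cross:
  assumes "orient (p (fst e)) (p (snd e)) (p (fst f)) < 0"
    and "orient (p (fst e)) (p (snd e)) (p (snd f)) < 0"
  shows "\<not> chords_cross p e f"
proof
  let ?o = "orient (p (fst e)) (p (snd e))"
  assume "chords_cross p e f"
  then obtain x where x: "x \<in> open_segment (p (fst e)) (p (snd e))"
    "x \<in> open_segment (p (fst f)) (p (snd f))"
    unfolding chords_cross_def by blast
  have "?o (p (fst e)) = 0" "?o (p (snd e)) = 0" by (simp_all add: orient_def)
  with x(1) have "?o x = 0" unfolding in_segment by (auto simp: orient_affine)
  moreover obtain t where "0 < t" "t < 1" "x = (1 - t) *\<^sub>R p (fst f) + t *\<^sub>R p (snd f)"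
    using x(2) unfolding in_segment by blast
  then have "?o x < 0"
    using assms by (simp add: orient_affine add_neg_neg mult_pos_neg)
  ultimately show False by simp
qed

text \<open>The intersection point divides each diagonal of the quadrilateral in the ratio of the areas of the
  two triangles that the other diagonal cuts off.\<close>

lemma interleaved_cross:
  fixes A B C D :: complex
  assumes o: "orient A B C < 0" "orient A B D < 0" "orient A C D < 0" "orient B C D < 0"
  shows "open_segment A C \<inter> open_segment B D \<noteq> {}"
proof -
  let ?s = "orient A B D / (orient A B D + orient B C D)"
  let ?t = "orient A B C / (orient A B C + orient A C D)"
  define X where "X = (1 - ?s) *\<^sub>R A + ?s *\<^sub>R C"
  have ne: "A \<noteq> C" "B \<noteq> D" using o by (auto simp: orient_def)
  have sum: "orient A B D + orient B C D = orient A B C + orient A C D"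
    by (simp add: orient_def algebra_simps)
  have neg: "orient A B D + orient B C D < 0" using o by simp
  have s: "0 < ?s" "?s < 1" using o by (auto simp: field_simps zero_less_divide_iff)
  have t: "0 < ?t" "?t < 1" using o by (auto simp: field_simps zero_less_divide_iff)
  have "X = (1 - ?t) *\<^sub>R B + ?t *\<^sub>R D"
    unfolding X_def sum[symmetric] complex_eq_iff
    using neg by (auto simp: field_simps) (simp_all add: orient_def algebra_simps)
  then have "X \<in> open_segment A C" "X \<in> open_segment B D"
    using s t ne X_def unfolding in_segment by blast+
  then show ?thesis by blast
qed

lemma interleaved_positive_basis:
  assumes "orient (p a) (p b) (p c) < 0" "orient (p a) (p c) (p d) < 0"
  shows "positive_basis (direction p (b, d)) (direction p (a, c))"
    and "\<not> positive_basis (direction p (a, c)) (direction p (b, d))"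
  using assms by (simp_all add: positive_basis_def direction_def orient_def algebra_simps)

section \<open>The two cycles in the circular diagram\<close>

definition skip_edge :: "nat \<Rightarrow> nat \<Rightarrow> nat \<times> nat" where
  "skip_edge N i = (i, cyclic_succ N (cyclic_succ N i))"

lemma clockwise3_skip:
  assumes "N \<ge> 3" "i \<in> {1..N}" "x \<in> {1..N}"
    and "x \<notin> {i, cyclic_succ N i, cyclic_succ N (cyclic_succ N i)}"
  shows "clockwise3 i (cyclic_succ N (cyclic_succ N i)) x"
  using assms cyclic_succ_cases[of i N] cyclic_succ_cases[of "cyclic_succ N i" N]
  unfolding clockwise3_def atLeastAtMost_iff insert_iff empty_iff by linarith

lemma clockwise3_four_consecutive:
  fixes N i :: nat
  defines "c \<equiv> cyclic_succ N"
  assumes "N \<ge> 4" "i \<in> {1..N}"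
  shows "clockwise3 i (c i) (c (c i))" "clockwise3 i (c i) (c (c (c i)))"
    "clockwise3 i (c (c i)) (c (c (c i)))" "clockwise3 (c i) (c (c i)) (c (c (c i)))"
  using assms(2,3) cyclic_succ_cases[of i N] cyclic_succ_cases[of "c i" N]
    cyclic_succ_cases[of "c (c i)" N]
  unfolding clockwise3_def atLeastAtMost_iff c_def by linarith+

lemma even_cyclic_succ:
  assumes "even N" "i \<in> {1..N}"
  shows "even (cyclic_succ N i) \<longleftrightarrow> odd i"
  using cyclic_succ_cases[OF assms(2)] assms(1) by auto

text \<open>Consecutive edges cross because their endpoints interleave, and the second is turned clockwise
  against the first. Hence the crossing is positive exactly when the second edge lies above.\<close>

lemma consecutive_skip_edges:
  assumes "clockwise_placement N p" "N \<ge> 4" "i \<in> {1..N}"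
  defines "e \<equiv> skip_edge N i" and "f \<equiv> skip_edge N (cyclic_succ N i)"
  shows "chords_cross p e f" "positive_basis (direction p f) (direction p e)"
    "\<not> positive_basis (direction p e) (direction p f)"
proof -
  let ?c = "cyclic_succ N"
  have mem: "i \<in> {1..N}" "?c i \<in> {1..N}" "?c (?c i) \<in> {1..N}" "?c (?c (?c i)) \<in> {1..N}"
    using assms(3) by (simp_all only: cyclic_succ_in)
  have o: "orient (p i) (p (?c i)) (p (?c (?c i))) < 0"
    "orient (p i) (p (?c i)) (p (?c (?c (?c i)))) < 0"
    "orient (p i) (p (?c (?c i))) (p (?c (?c (?c i)))) < 0"
    "orient (p (?c i)) (p (?c (?c i))) (p (?c (?c (?c i)))) < 0"
    using clockwise3_four_consecutive[OF assms(2,3)] mem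
    by (simp_all only: clockwise_placement_orient[OF assms(1)] insert_subset empty_subsetI simp_thms)
  show "chords_cross p e f"
    using interleaved_cross[OF o] by (simp add: chords_cross_def e_def f_def skip_edge_def)
  show "positive_basis (direction p f) (direction p e)"
    "\<not> positive_basis (direction p e) (direction p f)"
    using interleaved_positive_basis[of p, OF o(1,3)] by (simp_all add: e_def f_def skip_edge_def)
qed

lemma chords_cross_commute: "chords_cross p e f \<longleftrightarrow> chords_cross p f e"
  by (simp add: chords_cross_def Int_commute)

text \<open>If \<open>i\<close> and \<open>j\<close> have different parity and are not neighbours, then both endpoints of the edge at \<open>j\<close>
  lie on the arc from \<open>i + 2\<close> round to \<open>i\<close>, thus on one side of the edge at \<open>i\<close>.\<close>

lemma skip_edges_cross_iff:
  assumes "clockwise_placement N p" "N \<ge> 4" "even N" "i \<in> {1..N}" "j \<in> {1..N}" "even i \<noteq> even j"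
  shows "chords_cross p (skip_edge N i) (skip_edge N j) \<longleftrightarrow> j = cyclic_succ N i \<or> i = cyclic_succ N j"
proof
  assume "j = cyclic_succ N i \<or> i = cyclic_succ N j"
  then show "chords_cross p (skip_edge N i) (skip_edge N j)"
    using consecutive_skip_edges(1)[OF assms(1,2,4)] consecutive_skip_edges(1)[OF assms(1,2,5)]
      chords_cross_commute by blast
next
  let ?c = "cyclic_succ N"
  assume cross: "chords_cross p (skip_edge N i) (skip_edge N j)"
  show "j = ?c i \<or> i = ?c j"
  proof (rule ccontr)
    assume ne: "\<not> ?thesis"
    have mem: "?c i \<in> {1..N}" "?c (?c i) \<in> {1..N}" "?c j \<in> {1..N}" "?c (?c j) \<in> {1..N}"
      using assms(4,5) by (simp_all only: cyclic_succ_in)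
    have ev: "even (?c i) = odd i" "even (?c (?c i)) = even i" "even (?c (?c j)) = even j"
      using assms(3-5) mem by (simp_all only: even_cyclic_succ not_not)
    have "?c (?c j) \<noteq> ?c i"
      using ne permutes_inj[OF cyclic_succ_permutes[of N]] by (metis injD)
    then have "j \<notin> {i, ?c i, ?c (?c i)}" "?c (?c j) \<notin> {i, ?c i, ?c (?c i)}"
      using ne ev assms(6) by auto
    then have "clockwise3 i (?c (?c i)) j" "clockwise3 i (?c (?c i)) (?c (?c j))"
      using assms(2,4,5) mem by (auto intro!: clockwise3_skip simp del: atLeastAtMost_iff)
    then have "orient (p i) (p (?c (?c i))) (p j) < 0"
      "orient (p i) (p (?c (?c i))) (p (?c (?c j))) < 0"
      using assms(4,5) mem
      by (simp_all only: clockwise_placement_orient[OF assms(1)] insert_subset empty_subsetI simp_thms)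
    then have "\<not> chords_cross p (skip_edge N i) (skip_edge N j)"
      by (intro same_side_not_cross) (simp_all add: skip_edge_def)
    with cross show False by contradiction
  qed
qed

text \<open>The crossings correspond to the \<open>N\<close> pairs of consecutive skip edges, and the sign is \<open>1\<close> at the cyclic
  ascents of the height sequence \<open>h\<close> and \<open>- 1\<close> at the other positions.\<close>

lemma sum_crossing_signs:
  fixes h :: "nat \<Rightarrow> nat"
  assumes p: "clockwise_placement N p" and N: "N \<ge> 4" "even N"
    and P: "cycle_edges P = skip_edge N ` {i \<in> {1..N}. even i \<longleftrightarrow> b}"
    and Q: "cycle_edges Q = skip_edge N ` {i \<in> {1..N}. even i \<longleftrightarrow> \<not> b}"
    and int: "undirected ` cycle_edges P \<subseteq> interior_edges N" "undirected ` cycle_edges Q \<subseteq> interior_edges N"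
    and over: "\<And>i j. i \<in> {1..N} \<Longrightarrow> j \<in> {1..N} \<Longrightarrow>
      over (undirected (skip_edge N i)) (undirected (skip_edge N j)) \<longleftrightarrow> h j < h i"
    and h: "inj_on h {1..N}"
  shows "(\<Sum>(e, f)\<in>crossings N p P Q. crossing_sign p over e f) = 2 * int (cyclic_ascents N h) - int N"
proof -
  let ?c = "cyclic_succ N"
  \<comment> \<open>The crossing of the skip edges at \<open>i\<close> and its successor, with the edge of \<open>P\<close> first.\<close>
  define \<phi> where "\<phi> i = (if even i \<longleftrightarrow> b then (skip_edge N i, skip_edge N (?c i))
    else (skip_edge N (?c i), skip_edge N i))" for i
  have fst_skip: "fst (skip_edge N i) = i" for i by (simp add: skip_edge_def)
  have inj: "inj_on \<phi> {1..N}"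
  proof (rule inj_onI)
    fix i j assume i: "i \<in> {1..N}" and j: "j \<in> {1..N}" and eq: "\<phi> i = \<phi> j"
    \<comment> \<open>Two distinct positions could only share a crossing if each were the successor of the other.\<close>
    have no: False if "x = ?c y" "?c x = y" "y \<in> {1..N}" for x y
      using that N(1) cyclic_succ_cases[of y N] cyclic_succ_cases[of x N] cyclic_succ_in[of y N]
      unfolding atLeastAtMost_iff by linarith
    have "fst (fst (\<phi> i)) = fst (fst (\<phi> j))" "fst (snd (\<phi> i)) = fst (snd (\<phi> j))" using eq by simp_all
    then show "i = j"
      using no[of i j] no[of j i] i j
      by (auto simp: \<phi>_def fst_skip simp del: atLeastAtMost_iff split: if_splits)
  qed
  have crossings: "crossings N p P Q = \<phi> ` {1..N}"
  proof (intro equalityI subsetI)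
    fix x assume "x \<in> crossings N p P Q"
    then obtain e f where x: "x = (e, f)" "e \<in> cycle_edges P" "f \<in> cycle_edges Q" "chords_cross p e f"
      by (auto simp: crossings_def)
    then obtain i j where ij: "i \<in> {1..N}" "even i \<longleftrightarrow> b" "e = skip_edge N i"
      "j \<in> {1..N}" "even j \<longleftrightarrow> \<not> b" "f = skip_edge N j"
      unfolding P Q by blast
    have "j = ?c i \<or> i = ?c j"
      using x(4) skip_edges_cross_iff[OF p N ij(1,4)] ij by auto
    then have "x = \<phi> i \<or> x = \<phi> j" using x(1) ij by (auto simp: \<phi>_def)
    then show "x \<in> \<phi> ` {1..N}" using ij by blast
  next
    fix x assume "x \<in> \<phi> ` {1..N}"
    then obtain i where i: "i \<in> {1..N}" "x = \<phi> i" by blast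
    have "chords_cross p (skip_edge N i) (skip_edge N (?c i))"
      by (rule consecutive_skip_edges(1)[OF p N(1) i(1)])
    then have cc: "chords_cross p (fst x) (snd x)"
      using chords_cross_commute by (auto simp: i(2) \<phi>_def)
    have "fst x \<in> cycle_edges P" "snd x \<in> cycle_edges Q"
      using i(1) cyclic_succ_in[OF i(1)] even_cyclic_succ[OF N(2) i(1)]
      unfolding P Q i(2) \<phi>_def by auto
    with cc int show "x \<in> crossings N p P Q"
      by (auto simp: crossings_def case_prod_beta)
  qed
  have sign: "(case \<phi> i of (e, f) \<Rightarrow> crossing_sign p over e f) = (if h i < h (?c i) then 1 else -1)"
    if i: "i \<in> {1..N}" for i
  proof -
    have "?c i \<noteq> i" using cyclic_succ_cases[OF i] N(1) by auto
    then have "h (?c i) \<noteq> h i" using inj_onD[OF h] i cyclic_succ_in[OF i] by blast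
    then show ?thesis
      using over[OF i cyclic_succ_in[OF i]] over[OF cyclic_succ_in[OF i] i]
        consecutive_skip_edges(2,3)[OF p N(1) i]
      by (auto simp: \<phi>_def crossing_sign_def)
  qed
  have "(\<Sum>(e, f)\<in>crossings N p P Q. crossing_sign p over e f)
      = (\<Sum>i\<in>{1..N}. if h i < h (?c i) then 1 else -1)"
    unfolding crossings sum.reindex[OF inj] by (rule sum.cong) (simp_all only: sign comp_def)
  also have "\<dots> = (\<Sum>i\<in>{1..N}. 2 * (if h i < h (?c i) then 1 else 0) - 1)"
    by (rule sum.cong) auto
  also have "\<dots> = 2 * (\<Sum>i\<in>{1..N}. if h i < h (?c i) then 1 else 0) - int N"
    by (simp add: sum_subtractf sum_distrib_left)
  also have "(\<Sum>i\<in>{1..N}. if h i < h (?c i) then 1 else 0) = int (cyclic_ascents N h)"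
    by (simp add: cyclic_ascents_def sum.If_cases Int_def)
  finally show ?thesis .
qed

lemma cycle_edges_rotate: "cycle_edges (rotate m xs) = cycle_edges xs"
proof -
  have sub: "cycle_edges (rotate m xs) \<subseteq> cycle_edges xs" for m and xs :: "nat list"
  proof
    fix e assume "e \<in> cycle_edges (rotate m xs)"
    then obtain i where i: "i < length xs"
      "e = (rotate m xs ! i, rotate m xs ! (Suc i mod length xs))"
      by (auto simp: cycle_edges_def)
    let ?j = "(m + i) mod length xs"
    have pos: "length xs > 0" using i(1) by linarith
    have "Suc ?j mod length xs = (m + Suc i mod length xs) mod length xs"
      by (simp add: mod_simps)
    then have "e = (xs ! ?j, xs ! (Suc ?j mod length xs))"
      using i pos by (simp add: nth_rotate)
    moreover have "?j < length xs" using pos by simp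
    ultimately show "e \<in> cycle_edges xs" unfolding cycle_edges_def by blast
  qed
  have "rotate (m * length xs - m) (rotate m xs) = xs"
  proof (cases "xs = []")
    case False
    then have "m \<le> m * length xs" by (simp add: Suc_le_eq)
    then show ?thesis by (simp only: rotate_rotate le_add_diff_inverse2) (simp add: rotate_id)
  qed simp
  with sub[of m xs] sub[of "m * length xs - m" "rotate m xs"] show ?thesis by simp
qed

text \<open>Consecutive vertices of the cycle differ by at least \<open>2\<close>, since edges between neighbours are
  exterior. With \<open>n\<close> vertices among \<open>2 * n\<close> labels, and the closing edge from \<open>2 * n\<close> to \<open>1\<close> excluded as
  well, all these differences must be exactly \<open>2\<close>.\<close>

lemma strictly_increasing_interior_cycle:
  assumes n: "n \<ge> 1" and len: "length P = n"
    and cyc: "oriented_cycle (2 * n) P" and inc: "strictly_increasing_cycle P"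
    and int: "undirected ` cycle_edges P \<subseteq> interior_edges (2 * n)"
  obtains b where "set P = {i \<in> {1..2 * n}. even i \<longleftrightarrow> b}"
    and "cycle_edges P = skip_edge (2 * n) ` {i \<in> {1..2 * n}. even i \<longleftrightarrow> b}"
proof -
  obtain m where sorted: "sorted_wrt (<) (rotate m P)"
    using inc unfolding strictly_increasing_cycle_def by blast
  define ys where "ys = rotate m P"
  define a where "a = ys ! 0"
  have ys: "length ys = n" "set ys = set P" "cycle_edges ys = cycle_edges P"
    using len by (simp_all add: ys_def cycle_edges_rotate)
  have mem: "ys ! i \<in> {1..2 * n}" if "i < n" for i
    using that cyc ys nth_mem[of i ys] unfolding oriented_cycle_def by auto
  have ext: "undirected (x, x mod (2 * n) + 1) \<notin> undirected ` cycle_edges ys" if "x \<in> {1..2 * n}" for x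
  proof -
    have "undirected (x, x mod (2 * n) + 1) \<in> exterior_edges (2 * n)"
      using that unfolding exterior_edges_def undirected_def fst_conv snd_conv by blast
    then show ?thesis using int unfolding ys(3) interior_edges_def by blast
  qed
  have edge: "(ys ! i, ys ! (Suc i mod n)) \<in> cycle_edges ys" if "i < n" for i
    using that ys(1) unfolding cycle_edges_def by blast
  have step: "ys ! i + 2 \<le> ys ! Suc i" if "Suc i < n" for i
  proof -
    have lt: "ys ! i < ys ! Suc i"
      using sorted_wrt_nth_less[of "(<)" ys i "Suc i"] sorted that ys(1) by (simp add: ys_def)
    have "ys ! Suc i \<noteq> ys ! i + 1"
    proof
      assume eq: "ys ! Suc i = ys ! i + 1"
      have "ys ! i mod (2 * n) = ys ! i" using lt mem[OF that] by simp
      then show False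
        using edge[of i] that eq ext[OF mem[of i]] by (metis Suc_lessD imageI mod_less)
    qed
    with lt show ?thesis by simp
  qed
  have gap: "ys ! i + 2 * d \<le> ys ! (i + d)" if "i + d < n" for i d
    using that
  proof (induction d)
    case (Suc d)
    then show ?case using step[of "i + d"] by simp
  qed simp
  have a: "a = 1 \<or> a = 2"
    using gap[of 0 "n - 1"] mem[of 0] mem[of "n - 1"] n by (auto simp: a_def)
  have last: "ys ! (n - 1) \<le> a + 2 * (n - 1)"
  proof -
    have "ys ! (n - 1) \<noteq> 2 * n" if "a = 1"
    proof
      assume eq: "ys ! (n - 1) = 2 * n"
      have "(2 * n, 1) \<in> cycle_edges ys" using edge[of "n - 1"] n eq that by (simp add: a_def)
      then show False using ext[of "2 * n"] n by auto
    qed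
    then show ?thesis using a mem[of "n - 1"] n by auto
  qed
  have nth: "ys ! i = a + 2 * i" if "i < n" for i
    using gap[of 0 i] gap[of i "n - 1 - i"] last that by (simp add: a_def)
  have in_iff: "x \<in> {i \<in> {1..2 * n}. even i \<longleftrightarrow> even a} \<longleftrightarrow> (\<exists>i<n. x = a + 2 * i)" for x
  proof
    assume "x \<in> {i \<in> {1..2 * n}. even i \<longleftrightarrow> even a}"
    then have x: "1 \<le> x" "x \<le> 2 * n" "even x \<longleftrightarrow> even a" by auto
    have "a \<le> x" using a x by (cases "x = 1") auto
    then have "even (x - a)" using x(3) by simp
    then obtain i where "x - a = 2 * i" by (rule evenE)
    with \<open>a \<le> x\<close> have "x = a + 2 * i" by simp
    then show "\<exists>i<n. x = a + 2 * i" using x(2) a by (intro exI[of _ i]) auto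
  qed (use a in auto)
  have "set P = {i \<in> {1..2 * n}. even i \<longleftrightarrow> even a}"
    unfolding set_eq_iff in_iff using ys(2) nth by (auto simp: ys(1) in_set_conv_nth simp flip: ys(2))
  moreover have "cycle_edges P = skip_edge (2 * n) ` {i \<in> {1..2 * n}. even i \<longleftrightarrow> even a}"
  proof -
    have skip: "(ys ! i, ys ! (Suc i mod n)) = skip_edge (2 * n) (a + 2 * i)" if "i < n" for i
    proof (cases "Suc i < n")
      case True
      then show ?thesis using a nth[of i] nth[of "Suc i"] by (auto simp: skip_edge_def cyclic_succ_less)
    next
      case False
      then have "Suc i = n" using that by simp
      then show ?thesis
        using a nth[of i] nth[of 0] cyclic_succ_less[of "2 * n - 1" "2 * n"] cyclic_succ_last[of "2 * n"]
          cyclic_succ_less[of 1 "2 * n"]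
        by (auto simp: skip_edge_def)
    qed
    have "cycle_edges P = {(ys ! i, ys ! (Suc i mod n)) | i. i < n}"
      using cycle_edges_def[of ys] unfolding ys(1,3) .
    also have "\<dots> = (\<lambda>i. skip_edge (2 * n) (a + 2 * i)) ` {..<n}"
      unfolding image_def Bex_def lessThan_iff using skip by (intro Collect_cong) metis
    also have "\<dots> = skip_edge (2 * n) ` {i \<in> {1..2 * n}. even i \<longleftrightarrow> even a}"
    proof -
      have "{i \<in> {1..2 * n}. even i \<longleftrightarrow> even a} = (\<lambda>i. a + 2 * i) ` {..<n}"
        unfolding set_eq_iff in_iff image_iff Bex_def lessThan_iff by blast
      then show ?thesis by (simp only: image_image)
    qed
    finally show ?thesis .
  qed
  ultimately show ?thesis by (rule that)
qed

text \<open>For \<open>N = 4\<close> the two diagonals would each occur twice, with opposite directions.\<close>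

lemma inj_on_undirected_skip_edge:
  assumes "N \<ge> 5"
  shows "inj_on (\<lambda>i. undirected (skip_edge N i)) {1..N}"
proof (rule inj_onI)
  fix i j assume ij: "i \<in> {1..N}" "j \<in> {1..N}" "undirected (skip_edge N i) = undirected (skip_edge N j)"
  let ?c = "cyclic_succ N"
  have "i = j \<or> ?c (?c i) = j \<and> ?c (?c j) = i"
    using ij(3) by (auto simp: undirected_def skip_edge_def doubleton_eq_iff)
  then show "i = j"
    using assms ij(1,2) cyclic_succ_cases[of i N] cyclic_succ_cases[of "?c i" N]
      cyclic_succ_cases[of j N] cyclic_succ_cases[of "?c j" N]
    unfolding atLeastAtMost_iff by linarith
qed

section \<open>The distribution of the linking number\<close>

theorem theorem5:
  fixes n :: nat and p :: "nat \<Rightarrow> complex" and en :: "nat \<Rightarrow> nat set"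
    and P Q :: "nat list" and l :: int
  assumes "n \<ge> 3"
    and "clockwise_placement (2 * n) p"
    and "bij_betw en {1..num_interior (2 * n)} (interior_edges (2 * n))"
    and "oriented_cycle (2 * n) P" and "oriented_cycle (2 * n) Q"
    and "length P = n" and "length Q = n"
    and "set P \<inter> set Q = {}"
    and "strictly_increasing_cycle P" and "strictly_increasing_cycle Q"
    and "undirected ` cycle_edges P \<subseteq> interior_edges (2 * n)"
    and "undirected ` cycle_edges Q \<subseteq> interior_edges (2 * n)"
  shows "measure_pmf.prob (height_permutations (2 * n))
           {\<sigma>. linking_number (2 * n) p (lies_above (num_interior (2 * n)) en \<sigma>) P Q
                 = real_of_int l}
         = real (eulerian (2 * n - 1) (int n + l - 1)) / fact (2 * n - 1)"
proof -
  define N M where "N = 2 * n" and "M = num_interior (2 * n)"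
  define E where "E i = undirected (skip_edge N i)" for i
  \<comment> \<open>The position of an edge in the enumeration; its height is then \<open>\<sigma> (a i)\<close>.\<close>
  define a where "a i = inv_into {1..M} en (E i)" for i
  have N: "N \<ge> 5" "even N" using assms(1) by (simp_all add: N_def)
  have n1: "n \<ge> 1" using assms(1) by simp
  obtain b where P: "set P = {i \<in> {1..N}. even i \<longleftrightarrow> b}"
    "cycle_edges P = skip_edge N ` {i \<in> {1..N}. even i \<longleftrightarrow> b}"
    using strictly_increasing_interior_cycle[OF n1 assms(6,4,9,11)] unfolding N_def by blast
  obtain b' where Q: "set Q = {i \<in> {1..N}. even i \<longleftrightarrow> b'}"
    "cycle_edges Q = skip_edge N ` {i \<in> {1..N}. even i \<longleftrightarrow> b'}"
    using strictly_increasing_interior_cycle[OF n1 assms(7,5,10,12)] unfolding N_def by blast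
  have b': "b' = (\<not> b)"
  proof (rule ccontr)
    assume "b' \<noteq> (\<not> b)"
    \<comment> \<open>Equal parities would put the vertex \<open>2\<close> or \<open>1\<close> on both cycles.\<close>
    then have "(if b then 2 else 1) \<in> set P \<inter> set Q" using N(1) by (auto simp: P(1) Q(1))
    with assms(8) show False by blast
  qed
  have E_int: "E i \<in> interior_edges N" if "i \<in> {1..N}" for i
    using that assms(11,12) unfolding P(2) Q(2) b' E_def N_def[symmetric] by blast
  have en: "bij_betw en {1..M} (interior_edges N)" using assms(3) by (simp add: N_def M_def)
  have a: "a i \<in> {1..M}" "en (a i) = E i" if "i \<in> {1..N}" for i
    using E_int[OF that] en unfolding a_def bij_betw_def
    by (metis inv_into_into) (metis E_int[OF that] en bij_betw_def f_inv_into_f)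
  have inj_a: "inj_on a {1..N}"
    using inj_on_undirected_skip_edge[OF N(1)] a(2) unfolding E_def inj_on_def by metis
  have above: "lies_above M en \<sigma> (E i) (E j) \<longleftrightarrow> \<sigma> (a j) < \<sigma> (a i)"
    if "i \<in> {1..N}" "j \<in> {1..N}" for \<sigma> i j
    using a[OF that(1)] a[OF that(2)] en unfolding lies_above_def bij_betw_def by (metis inj_onD)
  have link: "linking_number N p (lies_above M en \<sigma>) P Q = real_of_int l
      \<longleftrightarrow> int (cyclic_ascents N (\<sigma> \<circ> a)) = int n + l" if "\<sigma> permutes {1..M}" for \<sigma>
  proof -
    have "(\<Sum>(e, f)\<in>crossings N p P Q. crossing_sign p (lies_above M en \<sigma>) e f)
        = 2 * int (cyclic_ascents N (\<sigma> \<circ> a)) - int N"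
    proof (rule sum_crossing_signs)
      show "inj_on (\<sigma> \<circ> a) {1..N}"
        using that inj_a by (auto intro!: comp_inj_on intro: permutes_inj_on)
      show "cycle_edges Q = skip_edge N ` {i \<in> {1..N}. even i \<longleftrightarrow> \<not> b}" using Q(2) b' by simp
    qed (use assms(2,11,12) N P(2) above in \<open>simp_all add: N_def[symmetric] E_def\<close>)
    then have "linking_number N p (lies_above M en \<sigma>) P Q
        = real_of_int (int (cyclic_ascents N (\<sigma> \<circ> a)) - int n)"
      unfolding linking_number_def by (simp add: N_def)
    then show ?thesis by (simp only: of_int_eq_iff) linarith
  qed
  let ?X = "card {\<sigma>. \<sigma> permutes {1..M} \<and> int (cyclic_ascents N (\<sigma> \<circ> a)) = int n + l}"
  let ?e = "eulerian (N - 1) (int n + l - 1)"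
  have "fact N * ?X = fact (card {1..M}) *
      card {\<tau>. \<tau> permutes {1..N} \<and> int (cyclic_ascents N \<tau>) = int n + l}"
  proof (rule relative_order_uniform)
    fix f g :: "nat \<Rightarrow> nat"
    assume "\<And>i j. i \<in> {1..N} \<Longrightarrow> j \<in> {1..N} \<Longrightarrow> f i < f j \<longleftrightarrow> g i < g j"
    then have "{i \<in> {1..N}. f i < f (cyclic_succ N i)} = {i \<in> {1..N}. g i < g (cyclic_succ N i)}"
      using cyclic_succ_in by blast
    then show "int (cyclic_ascents N f) = int n + l \<longleftrightarrow> int (cyclic_ascents N g) = int n + l"
      by (simp add: cyclic_ascents_def)
  qed (use a inj_a in auto)
  also have "card {\<tau>. \<tau> permutes {1..N} \<and> int (cyclic_ascents N \<tau>) = int n + l} = N * ?e"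
    using N(1) by (intro card_cyclic_ascents) simp
  finally have "fact N * ?X = fact M * (N * ?e)" by (simp only: card_atLeastAtMost diff_Suc_1)
  then have "real (fact N * ?X) = real (fact M * (N * ?e))" by (rule arg_cong)
  moreover have "fact N = real N * fact (N - 1)" using N(1) by (simp add: fact_reduce)
  ultimately have X: "real ?X / fact M = real ?e / fact (N - 1)"
    using N(1) by (simp add: field_simps)
  have "measure_pmf.prob (height_permutations N)
      {\<sigma>. linking_number N p (lies_above M en \<sigma>) P Q = real_of_int l}
    = real (card ({\<sigma>. \<sigma> permutes {1..M}} \<inter>
        {\<sigma>. linking_number N p (lies_above M en \<sigma>) P Q = real_of_int l})) / fact M"
  proof -
    have "{\<sigma>. \<sigma> permutes {1..M}} \<noteq> {}" using permutes_id by blast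
    then show ?thesis
      unfolding height_permutations_def
      by (simp add: measure_pmf_of_set finite_permutations card_permutations N_def M_def)
  qed
  also have "{\<sigma>. \<sigma> permutes {1..M}} \<inter>
      {\<sigma>. linking_number N p (lies_above M en \<sigma>) P Q = real_of_int l}
    = {\<sigma>. \<sigma> permutes {1..M} \<and> int (cyclic_ascents N (\<sigma> \<circ> a)) = int n + l}"
    using link by blast
  finally show ?thesis unfolding X by (simp add: N_def M_def)
qed

end
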